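(* Let $M$ be a unital JB$^*$-algebra. Then $\mathcal{U}^0(M)$ is a self-adjoint quadratic subset of $\mathcal{U}(M)$, that is, for all $u,w\in\mathcal{U}^0(M)$ the elements $w^*$ and $U_w(u)$ belong to $\mathcal{U}^0(M)$. Furthermore, $\mathcal{U}^0(M)$ is the smallest quadratic subset of $\mathcal{U}(M)$ containing the set $e^{iM_{sa}}=\{e^{ih}:h\in M_{sa}\}$. In particular, $$U_{\mathcal{U}^0(M)}\left(\mathcal{U}^0(M)\right)=\mathcal{U}^0(M)=\left\{U_{e^{ih_n}}\cdots U_{e^{ih_1}}(e^{ih_0}) : n\in\mathbb{N},\ h_j\in M_{sa}\ \forall\,0\le j\le n\right\}.$$
   Context: A complex Jordan algebra is a complex vector space $M$ with a commutative bilinear product $\circ$ satisfying $(a\circ b)\circ a^2=a\circ(b\circ a^2)$. For $a\in M$, $U_a(x)=2(a\circ x)\circ a-(a\circ a)\circ x$. A JB$^*$-algebra is a complex Jordan algebra $M$ with a complete norm satisfying $\|a\circ b\|\le\|a\|\,\|b\|$ and a conjugate linear algebra involution $*$ such that $\|U_a(a^* )\|=\|a\|^3$ for all $a\in M$; $M_{sa}=\{a\in M: a^*=a\}$. Assume $M$ has a unit $\mathbf{1}$. Powers are $a^0=\mathbf{1}$, $a^{n+1}=a\circ a^n$, and $e^a=\sum_{n\ge0}a^n/n!$. An element $a\in M$ is invertible if there is a (necessarily unique) $a^{-1}\in M$ with $a\circ a^{-1}=\mathbf{1}$ and $a^2\circ a^{-1}=a$; $M^{-1}$ is the set of invertible elements.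 An element $u$ is unitary if it is invertible with $u^{-1}=u^*$; $\mathcal{U}(M)$ is the set of unitaries with the norm topology, and $\mathcal{U}^0(M)$ (the principal component) is the connected component of $\mathcal{U}(M)$ containing $\mathbf{1}$. A subset $\mathfrak{M}\subseteq M^{-1}$ is called a quadratic subset if $U_{\mathfrak{M}}(\mathfrak{M})\subseteq\mathfrak{M}$, where $U_{A}(B)=\{U_a(b):a\in A,\ b\in B\}$. A subset is self-adjoint if it is stable under $*$. *)

theory Defs
  imports "HOL-Analysis.Analysis"
begin

text \<open>
  The Jordan product is written with the multiplication symbol. It is not associative, so the ring
  classes do not apply; the syntactic class \<open>power\<close> gives exactly the right-nested powers
  \<open>a ^ 0 = 1\<close>, \<open>a ^ Suc n = a * a ^ n\<close>.
\<close>

class complex_vector = real_vector +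
  fixes scaleC :: "complex \<Rightarrow> 'a \<Rightarrow> 'a" (infixr "*\<^sub>C" 75)
  assumes scaleC_add_right: "c *\<^sub>C (x + y) = c *\<^sub>C x + c *\<^sub>C y"
    and scaleC_add_left: "(c + d) *\<^sub>C x = c *\<^sub>C x + d *\<^sub>C x"
    and scaleC_scaleC: "c *\<^sub>C d *\<^sub>C x = (c * d) *\<^sub>C x"
    and scaleC_one: "1 *\<^sub>C x = x"
    and scaleR_scaleC: "r *\<^sub>R x = complex_of_real r *\<^sub>C x"

class complex_jordan_algebra = complex_vector + times +
  assumes jordan_commute: "a * b = b * a"
    and jordan_add_left: "(a + b) * c = a * c + b * c"
    and jordan_scaleC_left: "(z *\<^sub>C a) * b = z *\<^sub>C (a * b)"
    and jordan_identity: "(a * b) * (a * a) = a * (b * (a * a))"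

definition (in complex_jordan_algebra) U_op :: "'a \<Rightarrow> 'a \<Rightarrow> 'a" where
  "U_op a x = 2 *\<^sub>R ((a * x) * a) - (a * a) * x"

class jb_star_algebra = complex_jordan_algebra + banach +
  fixes star :: "'a \<Rightarrow> 'a"
  assumes norm_scaleC: "norm (z *\<^sub>C a) = cmod z * norm a"
    and norm_jordan_le: "norm (a * b) \<le> norm a * norm b"
    and star_star: "star (star a) = a"
    and star_add: "star (a + b) = star a + star b"
    and star_scaleC: "star (z *\<^sub>C a) = cnj z *\<^sub>C star a"
    and star_jordan: "star (a * b) = star a * star b"
    and norm_U_star: "norm (U_op a (star a)) = norm a ^ 3"

class unital_jb_star_algebra = jb_star_algebra + power +
  assumes jordan_one_left: "1 * a = a"

definition self_adjoints :: "'a::jb_star_algebra set" where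
  "self_adjoints = {a. star a = a}"

definition jexp :: "'a::unital_jb_star_algebra \<Rightarrow> 'a" where
  "jexp a = (\<Sum>n. a ^ n /\<^sub>R fact n)"

text \<open>
  The inverse is kept as a relation between \<open>a\<close> and \<open>b\<close> (\<open>b\<close> is the inverse of \<open>a\<close>), so that no
  definition relies on uniqueness of inverses.
\<close>

definition is_jordan_inverse :: "'a::unital_jb_star_algebra \<Rightarrow> 'a \<Rightarrow> bool" where
  "is_jordan_inverse a b \<longleftrightarrow> a * b = 1 \<and> a ^ 2 * b = a"

definition invertibles :: "'a::unital_jb_star_algebra set" where
  "invertibles = {a. \<exists>b. is_jordan_inverse a b}"

definition unitaries :: "'a::unital_jb_star_algebra set" where
  "unitaries = {u. is_jordan_inverse u (star u)}"

definition principal_component :: "'a::unital_jb_star_algebra set" where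
  "principal_component = connected_component_set unitaries 1"

definition U_set :: "'a::complex_jordan_algebra set \<Rightarrow> 'a set \<Rightarrow> 'a set" where
  "U_set A B = {U_op a b | a b. a \<in> A \<and> b \<in> B}"

definition quadratic_subset :: "'a::unital_jb_star_algebra set \<Rightarrow> bool" where
  "quadratic_subset S \<longleftrightarrow> S \<subseteq> invertibles \<and> U_set S S \<subseteq> S"

definition self_adjoint_subset :: "'a::jb_star_algebra set \<Rightarrow> bool" where
  "self_adjoint_subset S \<longleftrightarrow> star ` S \<subseteq> S"

definition exp_i_self_adjoints :: "'a::unital_jb_star_algebra set" where
  "exp_i_self_adjoints = {jexp (\<i> *\<^sub>C h) | h. h \<in> self_adjoints}"

primrec U_exp_chain :: "(nat \<Rightarrow> 'a::unital_jb_star_algebra) \<Rightarrow> nat \<Rightarrow> 'a" where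
  "U_exp_chain h 0 = jexp (\<i> *\<^sub>C h 0)"
| "U_exp_chain h (Suc n) = U_op (jexp (\<i> *\<^sub>C h (Suc n))) (U_exp_chain h n)"

end

theory Submission imports Defs
begin

text \<open>
  By the fundamental formula \<open>U_op (U_op x y) = U_op x \<circ> U_op y \<circ> U_op x\<close>, unitaries are closed under
  \<open>U_op\<close>, and \<open>U_op u\<close> is a contraction for unitary \<open>u\<close>. A unitary near \<open>1\<close> is \<open>jexp a\<close> with \<open>a\<close>
  small; local injectivity of \<open>jexp\<close> forces \<open>star a = - a\<close>, so that \<open>a = \<i> *\<^sub>C h\<close> with \<open>h\<close>
  self-adjoint. Writing a chain as \<open>T 1\<close> with \<open>T\<close> a product of contractions \<open>U_op (jexp (\<i> *\<^sub>C h))\<close>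
  moves this to a neighbourhood, of fixed radius, of any chain of exponentials. The chains thus form
  a clopen subset of the unitaries, and each chain is connected to \<open>1\<close>.
\<close>

section \<open>The fundamental formula\<close>

lemma jordan_add_right: "c * (a + b) = c * a + c * (b :: 'a::complex_jordan_algebra)"
  by (simp only: jordan_commute[of c] jordan_add_left)

lemma jordan_scaleR_left: "(r *\<^sub>R a) * b = r *\<^sub>R (a * (b :: 'a::complex_jordan_algebra))"
  by (simp add: scaleR_scaleC jordan_scaleC_left)

lemma jordan_scaleR_right: "a * (r *\<^sub>R b) = r *\<^sub>R (a * (b :: 'a::complex_jordan_algebra))"
  by (simp only: jordan_commute[of a] jordan_scaleR_left)

lemma jordan_zero_left: "0 * a = (0 :: 'a::complex_jordan_algebra)"
  using jordan_scaleR_left[of 0 0 a] by simp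

lemma jordan_zero_right: "a * 0 = (0 :: 'a::complex_jordan_algebra)"
  using jordan_scaleR_right[of a 0 0] by simp

lemma jordan_minus_left: "(- a) * b = - (a * (b :: 'a::complex_jordan_algebra))"
  using jordan_scaleR_left[of "-1" a b] by simp

lemma jordan_minus_right: "a * (- b) = - (a * (b :: 'a::complex_jordan_algebra))"
  using jordan_scaleR_right[of a "-1" b] by simp

lemma jordan_diff_left: "(a - b) * c = a * c - b * (c :: 'a::complex_jordan_algebra)"
  using jordan_add_left[of a "- b" c] by (simp add: jordan_minus_left)

lemma jordan_diff_right: "c * (a - b) = c * a - c * (b :: 'a::complex_jordan_algebra)"
  using jordan_add_right[of c a "- b"] by (simp add: jordan_minus_right)

lemmas jordan_linear =
  jordan_add_left jordan_add_right jordan_scaleR_left jordan_scaleR_right jordan_zero_left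
  jordan_zero_right jordan_minus_left jordan_minus_right jordan_diff_left jordan_diff_right

text \<open>Full polarization of \<open>jordan_identity\<close>, which is cubic in its repeated
  variable.\<close>

lemma linearized_jordan_identity:
  fixes a b c d :: "'a::complex_jordan_algebra"
  shows "a * ((b * c) * d) + b * ((c * a) * d) + c * ((a * b) * d)
    = (b * c) * (a * d) + (c * a) * (b * d) + (a * b) * (c * d)"
proof -
  define f where "f x = (x * d) * (x * x) - x * (d * (x * x))" for x :: 'a
  have f0: "f x = 0" for x
    by (simp add: f_def jordan_identity)
  \<comment> \<open>The alternating sum keeps exactly the part of the cubic map \<open>f\<close>
    that is linear in each of \<open>a\<close>, \<open>b\<close>, \<open>c\<close>. Each of its
    terms occurs twice by commutativity, whence the factor 2.\<close>
  have "f (a + b + c) - f (a + b) - f (b + c) - f (a + c) + f a + f b + f c = 0"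
    by (simp add: f0)
  then have "2 *\<^sub>R ((b * c) * (a * d) + (c * a) * (b * d) + (a * b) * (c * d)
      - (a * ((b * c) * d) + b * ((c * a) * d) + c * ((a * b) * d))) = 0"
    by (simp add: f_def jordan_linear jordan_commute scaleR_2 algebra_simps)
  then show ?thesis
    by simp
qed

text \<open>The Jordan triple product, taken without an involution on the middle variable so that it
  is linear in all three. Identities for \<open>U_op\<close>, its diagonal, can be derived from
  multilinear ones.\<close>

definition jordan_triple :: "'a::complex_jordan_algebra \<Rightarrow> 'a \<Rightarrow> 'a \<Rightarrow> 'a" where
  "jordan_triple x y z = (x * y) * z + (z * y) * x - (x * z) * y"

lemma jordan_triple_commute: "jordan_triple x y z = jordan_triple z y x"
  by (simp add: jordan_triple_def jordan_commute)

lemma U_op_eq_triple: "U_op x y = jordan_triple x y x"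
  by (simp add: U_op_def jordan_triple_def scaleR_2 jordan_commute)

lemmas triple_linear_defs = jordan_triple_def jordan_linear

text \<open>The two sides differ by three linearized Jordan identities, one for each summand of
  \<open>jordan_triple\<close> and with its sign; the last argument of the instance is the outer
  factor of that summand.\<close>

lemma jordan_triple_mult:
  fixes a u v w :: "'a::complex_jordan_algebra"
  shows "a * jordan_triple u v w
    = jordan_triple (a * u) v w - jordan_triple u (a * v) w + jordan_triple u v (a * w)"
proof -
  define p where "p x y z d = x * ((y * z) * d) + y * ((z * x) * d) + z * ((x * y) * d)
      - ((y * z) * (x * d) + (z * x) * (y * d) + (x * y) * (z * d))" for x y z d :: 'a
  have p0: "p x y z d = 0" for x y z d
    by (simp add: p_def linearized_jordan_identity)
  have "a * jordan_triple u v w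
      - (jordan_triple (a * u) v w - jordan_triple u (a * v) w + jordan_triple u v (a * w))
      = p a u v w + p a v w u - p a u w v"
    by (simp add: p_def triple_linear_defs jordan_commute algebra_simps)
  then show ?thesis
    by (simp add: p0)
qed

text \<open>Write L_x for multiplication by \<open>x\<close>. The right-hand side of the linearized
  identity at \<open>u\<close>, \<open>v\<close>, \<open>y\<close>, \<open>x\<close> is symmetric in
  \<open>x\<close> and \<open>y\<close>; equating the two left-hand sides says that the commutator
  [L_x, L_y] is a derivation.\<close>

lemma jordan_inner_derivation:
  fixes x y u v :: "'a::complex_jordan_algebra"
  shows "x * (y * (u * v)) - y * (x * (u * v))
    = (x * (y * u) - y * (x * u)) * v + u * (x * (y * v) - y * (x * v))"
  using linearized_jordan_identity[of u v y x] linearized_jordan_identity[of u v x y]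
  by (simp add: jordan_linear jordan_commute algebra_simps)

text \<open>The five-linear identity of Jordan triple systems. The operator
  \<open>jordan_triple x y\<close> is L_(x*y) + [L_x, L_y]: the first part acts on triples with a
  minus sign in the middle slot, the second as a derivation, and together they produce
  \<open>jordan_triple y x\<close> there.\<close>

lemma jordan_triple_identity:
  fixes x y u v w :: "'a::complex_jordan_algebra"
  shows "jordan_triple x y (jordan_triple u v w)
    = jordan_triple (jordan_triple x y u) v w - jordan_triple u (jordan_triple y x v) w
      + jordan_triple u v (jordan_triple x y w)"
proof -
  define d where "d z = x * (y * z) - y * (x * z)" for z
  have D: "jordan_triple x y z = (x * y) * z + d z" for z
    by (simp add: jordan_triple_def d_def jordan_commute algebra_simps)
  have D': "jordan_triple y x z = (x * y) * z - d z" for z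
    by (simp add: jordan_triple_def d_def jordan_commute algebra_simps)
  have d_lin: "d (p + q) = d p + d q" "d (p - q) = d p - d q" for p q
    by (simp_all add: d_def jordan_linear)
  have d_mult: "d (p * q) = d p * q + p * d q" for p q
    unfolding d_def by (rule jordan_inner_derivation)
  have d_triple: "d (jordan_triple u v w)
      = jordan_triple (d u) v w + jordan_triple u (d v) w + jordan_triple u v (d w)"
    by (simp add: jordan_triple_def d_lin d_mult jordan_linear algebra_simps)
  have "jordan_triple x y (jordan_triple u v w) 
     = (x * y) * jordan_triple u v w + d (jordan_triple u v w)"
    by (rule D)
  also have "\<dots> = jordan_triple ((x * y) * u + d u) v w - jordan_triple u ((x * y) * v - d v) w
      + jordan_triple u v ((x * y) * w + d w)"
    unfolding jordan_triple_mult d_triple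
    by (simp add: triple_linear_defs algebra_simps)
  finally show ?thesis
    by (simp only: D D')
qed

text \<open>The five-linear identity, used with \<open>y\<close> and \<open>v\<close> in both
  orders, gives A' = 2A - B and A = 2A' - B. Subtracting eliminates B and leaves 3(A - A') =
  0.\<close>

lemma jordan_triple_U:
  fixes x y v :: "'a::complex_jordan_algebra"
  shows "jordan_triple x y (U_op x v) = U_op x (jordan_triple y x v)"
    and "jordan_triple x y (U_op x v) = jordan_triple x v (U_op x y)"
proof -
  define A A' B where "A = jordan_triple x y (U_op x v)" and "A' = jordan_triple x v (U_op x y)"
    and "B = U_op x (jordan_triple y x v)"
  have 1: "A' = A - B + A"
    unfolding A_def A'_def B_def U_op_eq_triple
    by (subst jordan_triple_identity) (simp add: jordan_triple_commute)
  have 2: "A = A' - B + A'"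
    unfolding A_def A'_def B_def U_op_eq_triple
    by (subst jordan_triple_identity) (simp add: jordan_triple_commute)
  have "3 *\<^sub>R (A - A') = (A - (A' - B + A')) - (A' - (A - B + A))"
    by (simp add: scaleR_left.add[of 1 2, simplified] scaleR_2 algebra_simps)
  with 1 2 have "3 *\<^sub>R (A - A') = 0" by simp
  then show "A = A'" by simp
  with 1 show "A = B" by simp
qed

theorem fundamental_formula:
  fixes x y z :: "'a::complex_jordan_algebra"
  shows "U_op (U_op x y) z = U_op x (U_op y (U_op x z))"
proof -
  let ?T = "jordan_triple"
  let ?w = "U_op x y" and ?q = "?T y x (?T y x z)"
  have "U_op ?w z = ?T ?w z (?T x y x)"
    by (simp add: U_op_eq_triple)
  also have "\<dots> = ?T (?T ?w z x) y x - ?T x (?T z ?w y) x + ?T x y (?T ?w z x)"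
    by (rule jordan_triple_identity)
  also have "\<dots> = 2 *\<^sub>R ?T x y (?T x z ?w) - U_op x (?T z ?w y)"
    by (simp add: U_op_eq_triple scaleR_2 jordan_triple_commute)
  also have "?T x z ?w = U_op x (?T y x z)"
    by (metis jordan_triple_U)
  also have "?T x y (U_op x (?T y x z)) = U_op x ?q"
    by (rule jordan_triple_U)
  finally have 1: "U_op ?w z = U_op x (2 *\<^sub>R ?q - ?T z ?w y)"
    by (simp add: U_op_eq_triple triple_linear_defs algebra_simps)
  \<comment> \<open>With \<open>U_op x\<close> pulled out, its argument must be identified with
    \<open>U_op y (U_op x z)\<close>; two further instances of the five-linear identity do
    this.\<close>
  have 2: "?T z ?w y = ?T z x (U_op y x)"
    using jordan_triple_identity[of y x z x y]
    by (simp add: U_op_eq_triple jordan_triple_commute)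
  have "?T z x (U_op y x) = 2 *\<^sub>R ?q - U_op y (U_op x z)"
    using jordan_triple_identity[of z x y x y]
    by (simp add: U_op_eq_triple jordan_triple_commute scaleR_2)
  with 1 2 show ?thesis
    by simp
qed

section \<open>Jordan inverses\<close>

lemma U_op_linear:
  fixes a x y :: "'a::complex_jordan_algebra"
  shows "U_op a (x + y) = U_op a x + U_op a y" "U_op a (x - y) = U_op a x - U_op a y"
    "U_op a (r *\<^sub>R x) = r *\<^sub>R U_op a x"
  by (simp_all add: U_op_def jordan_linear algebra_simps)

lemma jordan_one_right: "a * 1 = (a :: 'a::unital_jb_star_algebra)"
  by (subst jordan_commute) (rule jordan_one_left)

lemma jordan_power2: "a ^ 2 = a * (a :: 'a::unital_jb_star_algebra)"
  by (simp add: numeral_2_eq_2 jordan_one_right)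

lemma U_op_one_left: "U_op 1 x = (x :: 'a::unital_jb_star_algebra)"
  by (simp add: U_op_def jordan_one_left jordan_one_right scaleR_2)

lemma U_op_one_right: "U_op a 1 = a * (a :: 'a::unital_jb_star_algebra)"
  by (simp add: U_op_def jordan_one_left jordan_one_right scaleR_2)

text \<open>By the Jordan identity L_a commutes with L_(a*a), and \<open>U_op a\<close> is a
  polynomial in these two operators.\<close>

lemma U_op_mult_self: "U_op a (a * x) = a * U_op a (x :: 'a::complex_jordan_algebra)"
proof -
  have "(a * a) * (a * x) = a * ((a * a) * x)"
    using jordan_identity[of a x] by (simp add: jordan_commute)
  then show ?thesis
    by (simp add: U_op_def jordan_linear jordan_commute)
qed

lemma is_jordan_inverse_iff:
  "is_jordan_inverse a b \<longleftrightarrow> a * b = 1 \<and> (a * a) * b = (a :: 'a::unital_jb_star_algebra)"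
  by (simp add: is_jordan_inverse_def jordan_power2)

text \<open>Write U_a for \<open>U_op a\<close>. By the fundamental formula, U_a b = a yields U_a
  U_b U_a = U_a, and U_b (a*a) = 1 yields U_b U_a U_a U_b = id. The latter makes U_b bijective and
  the squares of U_a and U_b mutually inverse, which permits cancellation in the former.\<close>

lemma U_op_inverse:
  fixes a b :: "'a::unital_jb_star_algebra"
  assumes "is_jordan_inverse a b"
  shows "U_op a b = a" "U_op a (U_op b x) = x" "U_op b (U_op a x) = x"
proof -
  have ab: "a * b = 1" and aab: "(a * a) * b = a"
    using assms by (auto simp: is_jordan_inverse_iff)
  have ba: "b * a = 1"
    by (subst jordan_commute) (rule ab)
  show Uab: "U_op a b = a"
    by (simp add: U_op_def ab aab jordan_one_left scaleR_2)
  \<comment> \<open>At \<open>a\<close>, \<open>a\<close>, \<open>b\<close>, \<open>b\<close> every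
    other term of the linearized identity equals 1: three on the left and two on the right.\<close>
  have "(a * a) * (b * b) = 1"
    using linearized_jordan_identity[of a a b b]
    by (simp add: ab ba aab jordan_one_left jordan_one_right)
  then have "(b * b) * (a * a) = 1"
    by (subst jordan_commute)
  moreover have "b * (a * a) = a"
    by (subst jordan_commute) (rule aab)
  ultimately have Ub: "U_op b (a * a) = 1"
    by (simp add: U_op_def ab scaleR_2)
  have 1: "U_op b (U_op a (U_op a (U_op b y))) = y" for y
  proof -
    have "U_op b (U_op a (U_op a (U_op b y))) = U_op b (U_op (U_op a 1) (U_op b y))"
      by (simp only: fundamental_formula U_op_one_left)
    also have "\<dots> = U_op (U_op b (a * a)) y"
      by (simp only: fundamental_formula U_op_one_right)
    finally show ?thesis
      by (simp only: Ub U_op_one_left)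
  qed
  have 2: "U_op a (U_op b (U_op a y)) = U_op a y" for y
    using fundamental_formula[of a b y] by (simp only: Uab)
  have b_inj: "inj (U_op b)"
    by (rule inj_on_inverseI[where g = "\<lambda>y. U_op b (U_op a (U_op a y))"]) (rule 1)
  have 3: "U_op a (U_op a (U_op b (U_op b y))) = y" for y
    by (rule injD[OF b_inj]) (rule 1)
  have 4: "U_op b (U_op b (U_op a (U_op a y))) = y" for y
  proof -
    \<comment> \<open>Fact \<open>1\<close> supplies this preimage of \<open>y\<close> under
      \<open>U_op b\<close>, which shows surjectivity.\<close>
    define w where "w = U_op a (U_op a (U_op b y))"
    have y: "y = U_op b w"
      by (simp only: w_def 1)
    show ?thesis
      unfolding y by (simp only: 1)
  qed
  show "U_op b (U_op a x) = x"
    using 4[of "U_op b (U_op a x)"] by (simp only: 2 4)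
  show "U_op a (U_op b x) = x"
    using 2[of "U_op a (U_op b (U_op b x))"] by (simp only: 3)
qed

text \<open>A converse that reduces invertibility to injectivity of \<open>U_op a\<close>, a
  property the fundamental formula handles well. As \<open>U_op a\<close> commutes with L_a, both
  \<open>a * b\<close> and 1 are sent to \<open>a * a\<close>.\<close>

lemma U_op_inj_imp_jordan_inverse:
  fixes a b :: "'a::unital_jb_star_algebra"
  assumes inj: "inj (U_op a)" and b: "U_op a b = a"
  shows "is_jordan_inverse a b"
proof -
  have "U_op a (a * b) = U_op a 1"
    by (simp add: U_op_mult_self b U_op_one_right)
  then have ab: "a * b = 1"
    by (rule injD[OF inj])
  have "(a * a) * b = 2 *\<^sub>R ((a * b) * a) - U_op a b"
    by (simp only: U_op_def diff_diff_eq2 add_diff_cancel_left')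
  also have "\<dots> = a"
    by (simp only: ab b jordan_one_left scaleR_2 add_diff_cancel_left')
  finally have "(a * a) * b = a" .
  with ab show ?thesis
    by (simp add: is_jordan_inverse_iff)
qed

lemma U_op_inj: "is_jordan_inverse a b \<Longrightarrow> inj (U_op a)"
  by (rule inj_on_inverseI[where g = "U_op b"]) (rule U_op_inverse(3))

lemma jordan_inverse_unique:
  assumes "is_jordan_inverse a b" "is_jordan_inverse a c"
  shows "b = c"
  by (rule injD[OF U_op_inj[OF assms(1)]]) (simp only: U_op_inverse(1)[OF assms(1)] U_op_inverse(1)[OF assms(2)])

text \<open>The factorization of \<open>U_op (U_op a b)\<close> is a composition of injections, and
  it telescopes on \<open>U_op a' b'\<close>.\<close>

lemma is_jordan_inverse_U_op:
  assumes "is_jordan_inverse a a'" "is_jordan_inverse b b'"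
  shows "is_jordan_inverse (U_op a b) (U_op a' b')"
proof (rule U_op_inj_imp_jordan_inverse)
  show "inj (U_op (U_op a b))"
    using inj_compose[OF inj_compose[OF U_op_inj[OF assms(1)] U_op_inj[OF assms(2)]]
        U_op_inj[OF assms(1)]]
    by (simp only: inj_def o_def fundamental_formula)
  show "U_op (U_op a b) (U_op a' b') = U_op a b"
    by (simp only: fundamental_formula U_op_inverse[OF assms(1)] U_op_inverse[OF assms(2)])
qed

section \<open>The involution and unitaries\<close>

lemma norm_U_op_le: "norm (U_op a x) \<le> 3 * norm a ^ 2 * norm (x :: 'a::jb_star_algebra)"
proof -
  have "norm ((a * x) * a) \<le> norm a ^ 2 * norm x"
    using norm_jordan_le[of "a * x" a] mult_right_mono[OF norm_jordan_le[of a x], of "norm a"]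
    by (simp add: power2_eq_square mult_ac)
  moreover have "norm ((a * a) * x) \<le> norm a ^ 2 * norm x"
    using norm_jordan_le[of "a * a" x] mult_right_mono[OF norm_jordan_le[of a a], of "norm x"]
    by (simp add: power2_eq_square mult_ac)
  ultimately show ?thesis
    unfolding U_op_def
    using norm_triangle_ineq4[of "2 *\<^sub>R ((a * x) * a)" "(a * a) * x"] by simp
qed

text \<open>The cubic norm axiom at \<open>star a\<close>, combined with the crude bound on
  \<open>U_op\<close>, lets the square of \<open>norm (star a)\<close> be cancelled. This yields
  continuity of \<open>star\<close>; the constant 3 enters the radii chosen later.\<close>

lemma norm_star_le: "norm (star a) \<le> 3 * norm (a :: 'a::jb_star_algebra)"
proof (cases "star a = 0")
  case False
  have "norm (star a) ^ 3 \<le> 3 * norm (star a) ^ 2 * norm a"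
    using norm_U_star[of "star a"] norm_U_op_le[of "star a" a] by (simp add: star_star)
  then have "norm (star a) ^ 2 * norm (star a) \<le> norm (star a) ^ 2 * (3 * norm a)"
    by (simp add: power3_eq_cube power2_eq_square mult_ac)
  with False show ?thesis
    by simp
qed simp

lemma bounded_linear_star: "bounded_linear (star :: 'a::jb_star_algebra \<Rightarrow> 'a)"
proof (rule bounded_linear_intro)
  show "star (r *\<^sub>R x) = r *\<^sub>R star x" for r and x :: 'a
    by (simp add: scaleR_scaleC star_scaleC)
  show "norm (star x) \<le> norm x * 3" for x :: 'a
    using norm_star_le[of x] by simp
qed (rule star_add)

lemma star_one: "star 1 = (1 :: 'a::unital_jb_star_algebra)"
  using star_jordan[of 1 "star 1 :: 'a"] by (simp add: star_star jordan_one_left jordan_one_right)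

lemma cube_le_self_imp_le_one: "x ^ 3 \<le> x \<Longrightarrow> x \<le> (1 :: real)"
  using power_strict_increasing[of 1 3 x] by (cases "x \<le> 1") auto

lemma norm_one_le: "norm (1 :: 'a::unital_jb_star_algebra) \<le> 1"
proof -
  have "norm (1 :: 'a) ^ 3 = norm (1 :: 'a)"
    using norm_U_star[of "1 :: 'a"] by (simp add: star_one U_op_one_left)
  then show ?thesis
    by (intro cube_le_self_imp_le_one) simp
qed

lemma bounded_bilinear_jordan: "bounded_bilinear ((*) :: 'a::jb_star_algebra \<Rightarrow> 'a \<Rightarrow> 'a)"
  by standard (auto simp: jordan_linear intro!: exI[of _ 1] norm_jordan_le)

lemmas continuous_on_jordan = bounded_bilinear.continuous_on[OF bounded_bilinear_jordan]

lemma bounded_linear_U_op: "bounded_linear (U_op (a :: 'a::jb_star_algebra))"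
  by (rule bounded_linear_intro[where K = "3 * norm a ^ 2"])
    (use norm_U_op_le[of a] in \<open>simp_all add: U_op_linear mult_ac\<close>)

lemma star_U_op: "star (U_op a x) = U_op (star a) (star (x :: 'a::jb_star_algebra))"
  by (simp add: U_op_def star_jordan bounded_linear_star[THEN bounded_linear.linear]
      linear_diff linear_scale)

lemma unitaries_star:
  assumes "u \<in> unitaries"
  shows "star u \<in> unitaries"
proof -
  have 1: "u * star u = 1" and 2: "(u * u) * star u = u"
    using assms by (auto simp: unitaries_def is_jordan_inverse_iff)
  have "(star u * star u) * u = star u"
    using arg_cong[OF 2, of star] by (simp add: star_jordan star_star)
  moreover have "star u * u = 1"
    by (subst jordan_commute) (rule 1)
  ultimately show ?thesis
    by (simp add: unitaries_def is_jordan_inverse_iff star_star)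
qed

lemma one_in_unitaries: "1 \<in> unitaries"
  by (simp add: unitaries_def is_jordan_inverse_iff star_one jordan_one_left)

lemma unitaries_U_op: "u \<in> unitaries \<Longrightarrow> w \<in> unitaries \<Longrightarrow> U_op w u \<in> unitaries"
  by (simp add: unitaries_def star_U_op is_jordan_inverse_U_op)

text \<open>By the fundamental formula \<open>T = U_op u\<close> satisfies
  \<open>\<parallel>T x\<parallel>\<^sup>3 = \<parallel>U_op (T x) (star (T x))\<parallel> = \<parallel>T (U_op x (star x))\<parallel> \<le> \<parallel>T\<parallel> \<parallel>x\<parallel>\<^sup>3\<close>,
  so \<open>\<parallel>T\<parallel>\<^sup>3 \<le> \<parallel>T\<parallel>\<close>.\<close>

lemma norm_U_op_unitary_le:
  fixes u x :: "'a::unital_jb_star_algebra"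
  assumes "u \<in> unitaries"
  shows "norm (U_op u x) \<le> norm x"
proof -
  have inv: "is_jordan_inverse u (star u)"
    using assms by (simp add: unitaries_def)
  let ?K = "onorm (U_op u)"
  note bl = bounded_linear_U_op[of u]
  have K0: "0 \<le> ?K"
    by (rule onorm_pos_le[OF bl])
  have "norm (U_op u x) \<le> root 3 ?K * norm x" for x
  proof -
    have "norm (U_op u x) ^ 3 = norm (U_op (U_op u x) (star (U_op u x)))"
      by (simp add: norm_U_star)
    also have "\<dots> = norm (U_op u (U_op x (star x)))"
      by (simp add: star_U_op fundamental_formula U_op_inverse[OF inv])
    also have "\<dots> \<le> ?K * norm x ^ 3"
      using onorm[OF bl, of "U_op x (star x)"] by (simp add: norm_U_star)
    also have "\<dots> = (root 3 ?K * norm x) ^ 3"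
      using K0 by (simp add: power_mult_distrib)
    finally show ?thesis
      by (rule power_le_imp_le_base[of _ 2, simplified]) (use K0 in auto)
  qed
  then have "?K \<le> root 3 ?K"
    by (intro onorm_bound) (use K0 in auto)
  then have "?K ^ 3 \<le> ?K"
    using K0 power_mono[of ?K "root 3 ?K" 3] by simp
  then have "?K \<le> 1"
    by (rule cube_le_self_imp_le_one)
  then show ?thesis
    using onorm[OF bl, of x] mult_right_mono[of ?K 1 "norm x"] by simp
qed

section \<open>Powers and exponentials\<close>

text \<open>The linearized identity is read as a formula (\<open>E\<close>) for the operator
  L_(a*(a*c)) in terms of L_a, L_c, L_(a*a) and L_(a*c), all of which commute with L_a. For
  \<open>c = a ^ n\<close> this is a two-step recursion on powers.\<close>

lemma operator_commute_step:
  fixes a c x :: "'a::complex_jordan_algebra"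
  assumes A: "\<And>x. a * (c * x) = c * (a * x)" and B: "\<And>x. a * ((a * c) * x) = (a * c) * (a * x)"
  shows "a * ((a * (a * c)) * x) = (a * (a * c)) * (a * x)"
proof -
  define s d where "s = a * a" and "d = a * c"
  have S: "a * (s * y) = s * (a * y)" for y
    using jordan_identity[of a y] by (simp add: s_def jordan_commute)
  have D: "a * (d * y) = d * (a * y)" for y
    unfolding d_def by (rule B)
  have E: "(a * d) * y = s * (c * y) + (d * (a * y) + d * (a * y)) - a * (a * (c * y)) - c * (a * (a * y))"
    for y
  proof -
    have "(a * d) * y - (s * (c * y) + (d * (a * y) + d * (a * y)) - a * (a * (c * y)) - c * (a * (a * y)))
      = (a * ((c * y) * a) + c * ((y * a) * a) + y * ((a * c) * a))
        - ((c * y) * (a * a) + (y * a) * (c * a) + (a * c) * (y * a))"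
      by (simp add: s_def d_def jordan_commute algebra_simps)
    then show ?thesis
      by (simp add: linearized_jordan_identity)
  qed
  have "a * ((a * d) * x) = (a * d) * (a * x)"
    by (simp only: E jordan_add_right jordan_diff_right S D A)
  then show ?thesis
    by (simp only: d_def)
qed

lemma jordan_power_operator_commute:
  fixes a x :: "'a::unital_jb_star_algebra"
  shows "a * (a ^ n * x) = a ^ n * (a * x)"
proof -
  \<comment> \<open>Two consecutive powers are carried along because the recursion needs
    both.\<close>
  have "(\<forall>x. a * (a ^ n * x) = a ^ n * (a * x)) \<and>
      (\<forall>x. a * (a ^ Suc n * x) = a ^ Suc n * (a * x))"
  proof (induction n)
    case 0
    show ?case
      by (simp add: jordan_one_left jordan_one_right)
  next
    case (Suc n)
    then show ?case
      using operator_commute_step[of a "a ^ n"] by simp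
  qed
  then show ?thesis
    by blast
qed

text \<open>Power associativity: since L_a commutes with multiplication by \<open>a ^ n\<close>, the
  extra factor \<open>a\<close> can be moved outside.\<close>

lemma jordan_power_add: "a ^ m * a ^ n = a ^ (m + n)" for a :: "'a::unital_jb_star_algebra"
proof (induction m)
  case 0
  show ?case
    by (simp add: jordan_one_left)
next
  case (Suc m)
  have "a ^ Suc m * a ^ n = a ^ n * (a * a ^ m)"
    by (subst jordan_commute) simp
  also have "\<dots> = a * (a ^ n * a ^ m)"
    by (rule jordan_power_operator_commute[symmetric])
  also have "a ^ n * a ^ m = a ^ m * a ^ n"
    by (rule jordan_commute)
  finally show ?case
    by (simp add: Suc)
qed

lemma jordan_power_scaleR: "(r *\<^sub>R a) ^ n = r ^ n *\<^sub>R (a :: 'a::unital_jb_star_algebra) ^ n"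
  by (induction n) (simp_all add: jordan_linear)

lemma star_power: "star (a ^ n) = star (a :: 'a::unital_jb_star_algebra) ^ n"
  by (induction n) (simp_all add: star_one star_jordan)

lemma norm_jordan_power_le: "norm (a ^ n) \<le> norm (a :: 'a::unital_jb_star_algebra) ^ n"
proof (induction n)
  case (Suc n)
  then show ?case
    using norm_jordan_le[of a "a ^ n"] mult_left_mono[OF Suc, of "norm a"] by simp
qed (simp add: norm_one_le)

text \<open>A mean value estimate by telescoping one factor at a time; indexing by
  \<open>Suc n\<close> avoids the exponent n - 1.\<close>

lemma norm_jordan_power_diff_le:
  fixes x y :: "'a::unital_jb_star_algebra"
  assumes "norm x \<le> r" "norm y \<le> r"
  shows "norm (x ^ Suc n - y ^ Suc n) \<le> real (Suc n) * r ^ n * norm (x - y)"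
proof (induction n)
  case 0
  show ?case
    by (simp add: jordan_one_right)
next
  case (Suc n)
  have r: "0 \<le> r"
    using assms(1) norm_ge_zero order_trans by blast
  have "x ^ Suc (Suc n) - y ^ Suc (Suc n)
      = (x - y) * x ^ Suc n + y * (x ^ Suc n - y ^ Suc n)"
    by (simp only: power_Suc[of _ "Suc n"] jordan_diff_left jordan_diff_right) simp
  also have "norm \<dots> \<le> norm ((x - y) * x ^ Suc n) + norm (y * (x ^ Suc n - y ^ Suc n))"
    by (rule norm_triangle_ineq)
  also have "norm ((x - y) * x ^ Suc n) \<le> norm (x - y) * r ^ Suc n"
    by (meson assms(1) mult_left_mono norm_ge_zero norm_jordan_le norm_jordan_power_le
        order_trans power_mono)
  also have "norm (y * (x ^ Suc n - y ^ Suc n)) \<le> r * (real (Suc n) * r ^ n * norm (x - y))"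
    by (meson Suc assms(2) mult_mono norm_ge_zero norm_jordan_le order_trans r)
  finally show ?case
    by (simp add: algebra_simps)
qed

section \<open>The exponential series and its one-parameter law\<close>

lemma norm_jexp_term_le:
  "norm (a ^ n /\<^sub>R fact n) \<le> norm (a :: 'a::unital_jb_star_algebra) ^ n /\<^sub>R fact n"
  by (simp add: mult_left_mono norm_jordan_power_le)

lemma summable_norm_jexp:
  fixes a :: "'a::unital_jb_star_algebra"
  shows "summable (\<lambda>n. norm (a ^ n /\<^sub>R fact n))"
  by (rule summable_comparison_test'[OF summable_exp_generic[of "norm a"], where N = 0])
    (use norm_jexp_term_le[where a = a] in simp)

lemmas summable_jexp = summable_norm_cancel[OF summable_norm_jexp]

text \<open>Square partial sums tend to the product by continuity; triangular ones are the partial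
  sums of the Cauchy series. Their difference is dominated by the same difference for the real
  series of norms, which tends to 0 by the classical Cauchy product.\<close>

lemma jordan_Cauchy_product_sums:
  fixes a b :: "nat \<Rightarrow> 'a::jb_star_algebra"
  assumes a: "summable (\<lambda>k. norm (a k))" and b: "summable (\<lambda>k. norm (b k))"
  shows "(\<lambda>k. \<Sum>i\<le>k. a i * b (k - i)) sums ((\<Sum>k. a k) * (\<Sum>k. b k))"
proof -
  interpret m: bounded_bilinear "(*) :: 'a \<Rightarrow> 'a \<Rightarrow> 'a"
    by (rule bounded_bilinear_jordan)
  let ?S1 = "\<lambda>n::nat. {..<n} \<times> {..<n}" and ?S2 = "\<lambda>n::nat. {(i, j). i + j < n}"
  let ?g = "\<lambda>(i, j). a i * b j" and ?f = "\<lambda>(i, j). norm (a i) * norm (b j)"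
  have sub: "?S2 n \<subseteq> ?S1 n" for n by auto
  have fin: "finite (?S1 n)" for n by simp
  have g1: "sum ?g (?S1 n) = (\<Sum>k<n. a k) * (\<Sum>k<n. b k)" for n
    by (simp only: m.sum_left, simp only: m.sum_right sum.cartesian_product)
  have f1: "sum ?f (?S1 n) = (\<Sum>k<n. norm (a k)) * (\<Sum>k<n. norm (b k))" for n
    by (simp add: sum_product sum.cartesian_product)
  have "(\<lambda>n. sum ?f (?S1 n)) \<longlonglongrightarrow> (\<Sum>k. norm (a k)) * (\<Sum>k. norm (b k))"
    unfolding f1 using a b by (intro tendsto_mult summable_LIMSEQ)
  moreover have "(\<lambda>n. sum ?f (?S2 n)) \<longlonglongrightarrow> (\<Sum>k. norm (a k)) * (\<Sum>k. norm (b k))"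
    using Cauchy_product_sums[of "\<lambda>k. norm (a k)" "\<lambda>k. norm (b k)"] a b
    by (simp add: sums_def sum.triangle_reindex)
  ultimately have "(\<lambda>n. sum ?f (?S1 n) - sum ?f (?S2 n)) \<longlonglongrightarrow> 0"
    using tendsto_diff by fastforce
  then have lim0: "(\<lambda>n. sum ?g (?S1 n) - sum ?g (?S2 n)) \<longlonglongrightarrow> 0"
  proof (rule Lim_null_comparison[rotated], intro always_eventually allI)
    fix n
    have "norm (sum ?g (?S1 n) - sum ?g (?S2 n)) = norm (sum ?g (?S1 n - ?S2 n))"
      by (simp only: sum_diff[OF fin sub])
    also have "\<dots> \<le> sum ?f (?S1 n - ?S2 n)"
      by (rule sum_norm_le) (auto simp: norm_jordan_le)
    also have "\<dots> = sum ?f (?S1 n) - sum ?f (?S2 n)"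
      by (simp only: sum_diff[OF fin sub])
    finally show "norm (sum ?g (?S1 n) - sum ?g (?S2 n)) \<le> sum ?f (?S1 n) - sum ?f (?S2 n)" .
  qed
  have "(\<lambda>n. sum ?g (?S1 n)) \<longlonglongrightarrow> (\<Sum>k. a k) * (\<Sum>k. b k)"
    unfolding g1
    by (intro m.tendsto summable_LIMSEQ summable_norm_cancel[OF a] summable_norm_cancel[OF b])
  then have "(\<lambda>n. sum ?g (?S2 n)) \<longlonglongrightarrow> (\<Sum>k. a k) * (\<Sum>k. b k)"
    using lim0 by (rule Lim_transform2)
  then show ?thesis
    by (simp only: sums_def sum.triangle_reindex)
qed

text \<open>By power associativity, multiples of a single \<open>a\<close> multiply like real power
  series: the n-th Cauchy term is the binomial formula for \<open>s\<close> and \<open>t\<close>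
  times \<open>a ^ n\<close>.\<close>

lemma jexp_add:
  fixes a :: "'a::unital_jb_star_algebra"
  shows "jexp (s *\<^sub>R a) * jexp (t *\<^sub>R a) = jexp ((s + t) *\<^sub>R a)"
proof -
  let ?e = "\<lambda>r n. (r *\<^sub>R a) ^ n /\<^sub>R fact n"
  have "(\<Sum>i\<le>n. ?e s i * ?e t (n - i)) = ?e (s + t) n" for n
  proof -
    have "(\<Sum>i\<le>n. ?e s i * ?e t (n - i))
        = (\<Sum>i\<le>n. ((s ^ i /\<^sub>R fact i) * (t ^ (n - i) /\<^sub>R fact (n - i))) *\<^sub>R a ^ n)"
      by (rule sum.cong) (simp_all add: jordan_power_scaleR jordan_linear jordan_power_add mult_ac)
    also have "\<dots> = ((s + t) ^ n /\<^sub>R fact n) *\<^sub>R a ^ n"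
      using exp_series_add_commuting[of s t n]
      by (simp only: scaleR_left.sum[symmetric] mult.commute)
    finally show ?thesis
      by (simp add: jordan_power_scaleR)
  qed
  then have "?e (s + t) sums (jexp (s *\<^sub>R a) * jexp (t *\<^sub>R a))"
    using jordan_Cauchy_product_sums[OF summable_norm_jexp[of "s *\<^sub>R a"] summable_norm_jexp[of "t *\<^sub>R a"]]
    by (simp add: jexp_def)
  then show ?thesis
    unfolding jexp_def by (simp add: sums_iff)
qed

lemma jexp_zero: "jexp 0 = (1 :: 'a::unital_jb_star_algebra)"
proof -
  have "(0 :: 'a) ^ n /\<^sub>R fact n = (if n = 0 then 1 else 0)" for n
    by (cases n) (simp_all add: jordan_linear)
  then show ?thesis
    using sums_single[of 0 "\<lambda>_. 1 :: 'a"] unfolding jexp_def by (simp add: sums_iff)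
qed

text \<open>A square root of an exponential; with \<open>U_op_one_right\<close> it exhibits
  \<open>jexp a\<close> as a value of a \<open>U_op\<close> at 1.\<close>

lemma jexp_double: "jexp ((1/2) *\<^sub>R a) * jexp ((1/2) *\<^sub>R a) = jexp (a :: 'a::unital_jb_star_algebra)"
  by (simp add: jexp_add)

lemma is_jordan_inverse_jexp: "is_jordan_inverse (jexp a) (jexp (- a :: 'a::unital_jb_star_algebra))"
  using jexp_add[of 1 a "-1"] jexp_add[of 1 a 1] jexp_add[of 2 a "-1"]
  by (simp add: is_jordan_inverse_iff jexp_zero)

lemma star_jexp: "star (jexp a) = jexp (star a :: 'a::unital_jb_star_algebra)"
proof -
  interpret s: bounded_linear "star :: 'a \<Rightarrow> 'a"
    by (rule bounded_linear_star)
  show ?thesis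
    by (simp add: jexp_def s.suminf[OF summable_jexp] s.scaleR star_power)
qed

text \<open>The derivative of \<open>jexp\<close> at \<open>0\<close> is the identity; on small balls this makes \<open>jexp\<close> a
  perturbation of the identity by a contraction.\<close>

lemma norm_jexp_diff_le:
  fixes x y :: "'a::unital_jb_star_algebra"
  assumes "norm x \<le> r" "norm y \<le> r"
  shows "norm (jexp x - jexp y - (x - y)) \<le> (exp r - 1) * norm (x - y)"
proof -
  define f where "f n = x ^ n /\<^sub>R fact n - y ^ n /\<^sub>R fact n" for n
  have sf: "summable f"
    unfolding f_def by (intro summable_diff summable_jexp)
  have "jexp x - jexp y = suminf f"
    unfolding jexp_def f_def by (intro suminf_diff summable_jexp)
  \<comment> \<open>Terms 0 and 1 contribute 0 and \<open>x - y\<close>, the linear part to be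
    removed.\<close>
  also have "\<dots> = (\<Sum>n. f (n + 2)) + (\<Sum>n<2. f n)"
    by (rule suminf_split_initial_segment[OF sf])
  also have "(\<Sum>n<2. f n) = x - y"
    by (simp add: f_def numeral_2_eq_2 jordan_one_right)
  finally have eq: "jexp x - jexp y - (x - y) = (\<Sum>n. f (n + 2))"
    by simp
  have sr: "(\<lambda>n. r ^ Suc n /\<^sub>R fact (Suc n)) sums (exp r - 1)"
    using exp_converges[of r] sums_Suc_iff[of "\<lambda>n. r ^ n /\<^sub>R fact n" "exp r - 1"] by simp
  \<comment> \<open>The factor n + 2 of the power estimate cancels in the factorial, so the tail is
    dominated by the exponential series of \<open>r\<close> without its constant term.\<close>
  have "norm (f (n + 2)) \<le> r ^ Suc n /\<^sub>R fact (Suc n) * norm (x - y)" for n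
  proof -
    have "norm (f (n + 2)) = norm (x ^ Suc (Suc n) - y ^ Suc (Suc n)) / fact (Suc (Suc n))"
      unfolding f_def
      by (simp only: scaleR_diff_right[symmetric] norm_scaleR) (simp add: divide_inverse_commute)
    also have "\<dots> \<le> (real (Suc (Suc n)) * r ^ Suc n * norm (x - y)) / fact (Suc (Suc n))"
      by (rule divide_right_mono[OF norm_jordan_power_diff_le[OF assms]]) simp
    also have "\<dots> = r ^ Suc n /\<^sub>R fact (Suc n) * norm (x - y)"
    proof -
      have "(c * p * q) / (c * d) = p /\<^sub>R d * q" if "c \<noteq> 0" for c d p q :: real
        using that by (simp add: divide_inverse)
      then show ?thesis
        by (simp only: fact_Suc[of "Suc n"])
    qed
    finally show ?thesis .
  qed
  then have "norm (\<Sum>n. f (n + 2)) \<le> (\<Sum>n. r ^ Suc n /\<^sub>R fact (Suc n) * norm (x - y))"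
    by (rule norm_suminf_le) (intro summable_mult2 sums_summable[OF sr])
  also have "\<dots> = (exp r - 1) * norm (x - y)"
    using sums_mult2[OF sr] by (rule sums_unique[symmetric])
  finally show ?thesis
    by (simp only: eq)
qed

text \<open>Fixes the working radius 1/4, on which \<open>jexp\<close> minus the identity has
  Lipschitz constant at most 1/2.\<close>

lemma exp_quarter_le: "exp (1/4 :: real) - 1 \<le> 1/2"
  using exp_bound_lemma[of "1/4 :: real"] by simp

lemma jexp_inj_small:
  fixes x y :: "'a::unital_jb_star_algebra"
  assumes "norm x \<le> 1/4" "norm y \<le> 1/4" "jexp x = jexp y"
  shows "x = y"
proof -
  have "norm (x - y) \<le> (exp (1/4) - 1) * norm (x - y)"
    using norm_jexp_diff_le[OF assms(1,2)] assms(3) by (simp add: norm_minus_commute)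
  also have "\<dots> \<le> 1/2 * norm (x - y)"
    by (rule mult_right_mono[OF exp_quarter_le]) simp
  finally show ?thesis
    by simp
qed

text \<open>Banach's fixed point theorem for \<open>G\<close>, whose fixed points are the logarithms
  of \<open>v\<close>. The contraction factor 1/2 together with \<open>norm (G 0)\<close> \<le> r/2
  keeps the ball of radius \<open>r\<close> invariant.\<close>

lemma jexp_surj_near_one:
  fixes v :: "'a::unital_jb_star_algebra"
  assumes r: "0 \<le> r" "r \<le> 1/4" and v: "norm (v - 1) \<le> r / 2"
  shows "\<exists>a. norm a \<le> r \<and> jexp a = v"
proof -
  define G where "G a = v - (jexp a - a)" for a
  have G: "dist (G x) (G y) \<le> 1/2 * dist x y" if "norm x \<le> r" "norm y \<le> r" for x y
  proof -
    have "dist (G x) (G y) = norm (jexp x - jexp y - (x - y))"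
      by (simp add: G_def dist_norm norm_minus_commute algebra_simps)
    also have "\<dots> \<le> (exp (1/4) - 1) * norm (x - y)"
      using that r by (intro norm_jexp_diff_le) auto
    also have "\<dots> \<le> 1/2 * norm (x - y)"
      by (rule mult_right_mono[OF exp_quarter_le]) simp
    finally show ?thesis
      by (simp add: dist_norm)
  qed
  have G0: "G 0 = v - 1"
    by (simp add: G_def jexp_zero)
  have "\<exists>!a\<in>cball 0 r. G a = a"
  proof (rule Banach_fix)
    show "complete (cball (0 :: 'a) r)"
      by (simp add: complete_eq_closed)
    show "cball (0 :: 'a) r \<noteq> {}"
      using r by simp
    show "G ` cball 0 r \<subseteq> cball 0 r"
    proof clarify
      fix a :: 'a assume "a \<in> cball 0 r"
      then have a: "norm a \<le> r" by simp
      have "norm (G a) \<le> dist (G a) (G 0) + norm (G 0)"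
        using norm_triangle_ineq[of "G a - G 0" "G 0"] by (simp add: dist_norm)
      also have "\<dots> \<le> 1/2 * norm a + r / 2"
        using G[OF a, of 0] r v by (simp add: G0)
      finally show "G a \<in> cball 0 r"
        using a by simp
    qed
    show "dist (G x) (G y) \<le> 1/2 * dist x y" if "x \<in> cball 0 r" "y \<in> cball 0 r" for x y
      using G that by simp
  qed auto
  then obtain a where "norm a \<le> r" "G a = a"
    by auto
  then show ?thesis
    by (intro exI[of _ a]) (simp add: G_def algebra_simps)
qed

text \<open>Adding the identity back to the perturbation estimate gives a Lipschitz constant on
  every ball.\<close>

lemma continuous_jexp: "continuous_on UNIV (jexp :: 'a::unital_jb_star_algebra \<Rightarrow> 'a)"
proof -
  have "continuous_on (ball 0 r) (jexp :: 'a \<Rightarrow> 'a)" for r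
  proof (rule lipschitz_on_continuous_on[where L = "exp \<bar>r\<bar>"], rule lipschitz_onI)
    fix x y :: 'a assume "x \<in> ball 0 r" "y \<in> ball 0 r"
    then have "norm (jexp x - jexp y - (x - y)) \<le> (exp \<bar>r\<bar> - 1) * norm (x - y)"
      by (intro norm_jexp_diff_le) auto
    then show "dist (jexp x) (jexp y) \<le> exp \<bar>r\<bar> * dist x y"
      using norm_triangle_ineq[of "jexp x - jexp y - (x - y)" "x - y"]
      by (simp add: dist_norm algebra_simps)
  qed simp
  then have "isCont (jexp :: 'a \<Rightarrow> 'a) x" for x
    by (rule continuous_on_interior[where S = "ball 0 (norm x + 1)"]) simp
  then show ?thesis
    by (simp add: continuous_at_imp_continuous_on)
qed

section \<open>The principal component\<close>

lemma scaleC_minus: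
  fixes x :: "'a::complex_vector"
  shows "c *\<^sub>C (- x) = - (c *\<^sub>C x)" "(- c) *\<^sub>C x = - (c *\<^sub>C x)"
proof -
  have minus: "- y = (- 1) *\<^sub>C y" for y :: 'a
    using scaleR_scaleC[of "-1" y] by simp
  show "c *\<^sub>C (- x) = - (c *\<^sub>C x)"
    by (subst (1 2) minus) (simp add: scaleC_scaleC)
  show "(- c) *\<^sub>C x = - (c *\<^sub>C x)"
    by (subst minus) (simp add: scaleC_scaleC)
qed

lemma star_minus: "star (- a) = - star (a :: 'a::jb_star_algebra)"
  using bounded_linear_star by (rule linear_neg[OF bounded_linear.linear])

lemma star_ii_scaleC:
  "h \<in> self_adjoints \<Longrightarrow> star (\<i> *\<^sub>C h) = - (\<i> *\<^sub>C (h :: 'a::jb_star_algebra))"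
  by (simp add: self_adjoints_def star_scaleC scaleC_minus)

lemma scaleR_self_adjoints:
  "h \<in> self_adjoints \<Longrightarrow> r *\<^sub>R h \<in> self_adjoints" for h :: "'a::jb_star_algebra"
  by (simp add: self_adjoints_def scaleR_scaleC star_scaleC)

lemma scaleC_scaleR: "c *\<^sub>C (r *\<^sub>R x) = r *\<^sub>R (c *\<^sub>C (x :: 'a::complex_vector))"
  by (simp add: scaleR_scaleC scaleC_scaleC mult.commute)

lemma jexp_in_unitaries: "h \<in> self_adjoints \<Longrightarrow> jexp (\<i> *\<^sub>C h) \<in> unitaries"
  by (simp add: unitaries_def star_jexp star_ii_scaleC is_jordan_inverse_jexp)

lemma unitary_near_one_eq_jexp:
  fixes u :: "'a::unital_jb_star_algebra"
  assumes u: "u \<in> unitaries" and near: "norm (u - 1) \<le> 1/24"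
  shows "\<exists>h\<in>self_adjoints. u = jexp (\<i> *\<^sub>C h)"
proof -
  \<comment> \<open>The radius 1/12 ensures that \<open>star a\<close>, of norm at most 3/12, stays
    in the injectivity ball of radius 1/4; surjectivity at this radius requires distance 1/24 from
    1.\<close>
  obtain a where a: "norm a \<le> 1/12" and ja: "jexp a = u"
    using jexp_surj_near_one[of "1/12" u] near by auto
  \<comment> \<open>Both \<open>jexp (- a)\<close> and \<open>star u\<close> invert
    \<open>u\<close>, so uniqueness of inverses compares \<open>jexp\<close> at \<open>- a\<close>
    and at \<open>star a\<close>.\<close>
  have "is_jordan_inverse u (jexp (- a))"
    using is_jordan_inverse_jexp[of a] by (simp add: ja)
  moreover have "is_jordan_inverse u (star u)"
    using u by (simp add: unitaries_def)
  ultimately have "jexp (- a) = star u"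
    by (rule jordan_inverse_unique)
  then have "jexp (star a) = jexp (- a)"
    by (simp add: star_jexp ja[symmetric])
  moreover have "norm (star a) \<le> 1/4" "norm (- a) \<le> 1/4"
    using norm_star_le[of a] a by simp_all
  ultimately have "star a = - a"
    by (rule jexp_inj_small[rotated 2])
  then have "(- \<i>) *\<^sub>C a \<in> self_adjoints"
    by (simp add: self_adjoints_def star_scaleC scaleC_minus star_minus)
  moreover have "\<i> *\<^sub>C (- \<i>) *\<^sub>C a = a"
    by (simp add: scaleC_scaleC scaleC_one)
  ultimately show ?thesis
    using ja by (intro bexI[of _ "(- \<i>) *\<^sub>C a"]) simp_all
qed

section \<open>Closure properties of the principal component\<close>

lemma principal_component_subset: "principal_component \<subseteq> unitaries"
  unfolding principal_component_def by (rule connected_component_subset)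

lemma one_in_principal_component: "1 \<in> principal_component"
  by (simp add: principal_component_def one_in_unitaries)

lemma connected_principal_component: "connected principal_component"
  unfolding principal_component_def by (rule connected_connected_component)

lemma principal_component_maximal:
  "1 \<in> T \<Longrightarrow> connected T \<Longrightarrow> T \<subseteq> unitaries \<Longrightarrow> T \<subseteq> principal_component"
  unfolding principal_component_def by (rule connected_component_maximal)

text \<open>The path t \<mapsto> e^(ith), for t from 0 to 1, joins 1 to e^(ih) inside the
  unitaries.\<close>

lemma jexp_in_principal_component:
  fixes h :: "'a::unital_jb_star_algebra"
  assumes h: "h \<in> self_adjoints"
  shows "jexp (\<i> *\<^sub>C h) \<in> principal_component"
proof -
  define p where "p t = jexp (t *\<^sub>R (\<i> *\<^sub>C h))" for t :: real
  have "continuous_on {0..1} p"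
    unfolding p_def by (intro continuous_on_compose2[OF continuous_jexp] continuous_intros) auto
  then have "connected (p ` {0..1})"
    by (rule connected_continuous_image) simp
  moreover have "p ` {0..1} \<subseteq> unitaries"
    using jexp_in_unitaries[OF scaleR_self_adjoints[OF h]] by (auto simp: p_def scaleC_scaleR)
  moreover have "1 \<in> p ` {0..1}"
    by (rule image_eqI[of _ _ 0]) (simp_all add: p_def jexp_zero)
  ultimately have "p ` {0..1} \<subseteq> principal_component"
    by (intro principal_component_maximal)
  moreover have "jexp (\<i> *\<^sub>C h) \<in> p ` {0..1}"
    by (rule image_eqI[of _ _ 1]) (simp_all add: p_def)
  ultimately show ?thesis ..
qed

lemma star_principal_component:
  assumes "u \<in> principal_component"
  shows "star u \<in> (principal_component :: 'a::unital_jb_star_algebra set)"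
proof -
  have "connected (star ` principal_component :: 'a set)"
    by (intro connected_continuous_image connected_principal_component
        linear_continuous_on bounded_linear_star)
  moreover have "1 \<in> star ` (principal_component :: 'a set)"
    using star_one one_in_principal_component by (metis image_eqI)
  moreover have "star ` principal_component \<subseteq> (unitaries :: 'a set)"
    using principal_component_subset unitaries_star by blast
  ultimately have "star ` principal_component \<subseteq> (principal_component :: 'a set)"
    by (intro principal_component_maximal)
  with assms show ?thesis
    by blast
qed

text \<open>The product of the component with itself is connected, and \<open>U_op\<close> maps it
  continuously into the unitaries, sending (1, 1) to 1.\<close>

lemma U_op_principal_component:
  assumes "w \<in> principal_component" "u \<in> principal_component"
  shows "U_op w u \<in> (principal_component :: 'a::unital_jb_star_algebra set)"
proof -
  let ?P = "principal_component :: 'a set" and ?f = "\<lambda>(w, u). U_op w u :: 'a"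
  have "continuous_on (?P \<times> ?P) ?f"
    unfolding U_op_def case_prod_beta by (intro continuous_intros continuous_on_jordan)
  then have "connected (?f ` (?P \<times> ?P))"
    by (intro connected_continuous_image connected_Times connected_principal_component)
  moreover have "1 \<in> ?f ` (?P \<times> ?P)"
    using one_in_principal_component by (intro image_eqI[of _ _ "(1, 1)"]) (auto simp: U_op_one_left)
  moreover have "?f ` (?P \<times> ?P) \<subseteq> unitaries"
    using principal_component_subset by (auto intro!: unitaries_U_op)
  ultimately have "?f ` (?P \<times> ?P) \<subseteq> ?P"
    by (intro principal_component_maximal)
  with assms show ?thesis
    by auto
qed

text \<open>The right-hand side of the claimed formula. Directly, only stability under
  \<open>U_op\<close> of single exponentials is shown; stability under \<open>U_op\<close> of
  arbitrary chains follows from the identification with the component.\<close>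

definition exp_chains :: "'a::unital_jb_star_algebra set" where
  "exp_chains = {U_exp_chain h n | h n. \<forall>j\<le>n. h j \<in> self_adjoints}"

lemma U_exp_chain_cong: "(\<And>j. j \<le> n \<Longrightarrow> h j = k j) \<Longrightarrow> U_exp_chain h n = U_exp_chain k n"
  by (induction n) auto

lemma jexp_in_exp_chains: "h \<in> self_adjoints \<Longrightarrow> jexp (\<i> *\<^sub>C h) \<in> exp_chains"
  unfolding exp_chains_def by (intro CollectI exI[of _ "\<lambda>_. h"] exI[of _ 0]) simp

lemma one_in_exp_chains: "1 \<in> (exp_chains :: 'a::unital_jb_star_algebra set)"
proof -
  have "\<i> *\<^sub>C (0 :: 'a) = 0"
    using scaleC_scaleR[of \<i> 0 "0 :: 'a"] by simp
  moreover have "(0 :: 'a) \<in> self_adjoints"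
    using linear_0[OF bounded_linear.linear[OF bounded_linear_star]] by (simp add: self_adjoints_def)
  ultimately show ?thesis
    using jexp_in_exp_chains[of "0 :: 'a"] by (simp add: jexp_zero)
qed

lemma U_op_jexp_in_exp_chains:
  assumes h: "h \<in> self_adjoints" and u: "u \<in> exp_chains"
  shows "U_op (jexp (\<i> *\<^sub>C h)) u \<in> exp_chains"
proof -
  obtain k n where k: "\<forall>j\<le>n. k j \<in> self_adjoints" and "u = U_exp_chain k n"
    using u by (auto simp: exp_chains_def)
  \<comment> \<open>Updating the sequence at \<open>Suc n\<close> leaves the earlier chain
    unchanged.\<close>
  then have "U_op (jexp (\<i> *\<^sub>C h)) u = U_exp_chain (k(Suc n := h)) (Suc n)"
    using U_exp_chain_cong[of n k "k(Suc n := h)"] by simp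
  moreover have "\<forall>j\<le>Suc n. (k(Suc n := h)) j \<in> self_adjoints"
    using h k by (auto simp: le_Suc_eq)
  ultimately show ?thesis
    unfolding exp_chains_def by blast
qed

text \<open>Serves twice: with the component as \<open>S\<close> it gives one inclusion of the
  formula, and with an arbitrary quadratic \<open>S\<close> it gives minimality.\<close>

lemma exp_chains_minimal:
  fixes S :: "'a::unital_jb_star_algebra set"
  assumes "exp_i_self_adjoints \<subseteq> S" "U_set S S \<subseteq> S"
  shows "exp_chains \<subseteq> S"
proof -
  have e: "jexp (\<i> *\<^sub>C h) \<in> S" if "h \<in> self_adjoints" for h
    using assms(1) that by (auto simp: exp_i_self_adjoints_def)
  have "U_exp_chain h n \<in> S" if "\<forall>j\<le>n. h j \<in> self_adjoints" for h n
    using that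
  proof (induction n)
    case (Suc n)
    then have "U_op (jexp (\<i> *\<^sub>C h (Suc n))) (U_exp_chain h n) \<in> U_set S S"
      using e by (auto simp: U_set_def)
    with assms(2) show ?case
      by auto
  qed (simp add: e)
  then show ?thesis
    by (auto simp: exp_chains_def)
qed

text \<open>Undoing the outermost factor with a contraction \<open>U_op (jexp (- \<i> *\<^sub>C h))\<close> keeps the distance
  bound, so the neighbourhood has the same radius around every chain.\<close>

lemma unitary_near_chain:
  fixes u :: "'a::unital_jb_star_algebra"
  assumes "\<forall>j\<le>n. h j \<in> self_adjoints" "u \<in> unitaries" "norm (u - U_exp_chain h n) \<le> 1/24"
  shows "u \<in> exp_chains"
proof -
  \<comment> \<open>Peels off one factor: \<open>u\<close> is moved by the inverse of
    \<open>U_op (jexp (\<i> *\<^sub>C k))\<close>, landing at least as close to the inner element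
    \<open>c\<close>.\<close>
  have step: "U_op (jexp (- (\<i> *\<^sub>C k))) u \<in> unitaries
      \<and> norm (U_op (jexp (- (\<i> *\<^sub>C k))) u - c) \<le> 1/24
      \<and> u = U_op (jexp (\<i> *\<^sub>C k)) (U_op (jexp (- (\<i> *\<^sub>C k))) u)"
    if k: "k \<in> self_adjoints" and u: "u \<in> unitaries"
      and near: "norm (u - U_op (jexp (\<i> *\<^sub>C k)) c) \<le> 1/24" for k u c :: 'a
  proof -
    let ?e = "jexp (\<i> *\<^sub>C k)" and ?e' = "jexp (- (\<i> *\<^sub>C k))"
    note inv = U_op_inverse[OF is_jordan_inverse_jexp[of "\<i> *\<^sub>C k"]]
    have e': "?e' \<in> unitaries"
      using unitaries_star[OF jexp_in_unitaries[OF k]] by (simp add: star_jexp star_ii_scaleC k)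
    have "norm (U_op ?e' u - c) = norm (U_op ?e' (u - U_op ?e c))"
      by (simp add: U_op_linear inv)
    also have "\<dots> \<le> norm (u - U_op ?e c)"
      by (rule norm_U_op_unitary_le[OF e'])
    finally show ?thesis
      using near by (auto simp: inv unitaries_U_op[OF u e'])
  qed
  show ?thesis
    using assms
  proof (induction n arbitrary: u)
    case 0
    \<comment> \<open>The innermost exponential is itself \<open>U_op\<close> of its square root
      applied to 1, so one more peeling brings \<open>u\<close> near 1, where logarithms
      exist.\<close>
    let ?k = "(1/2) *\<^sub>R h 0"
    have k: "?k \<in> self_adjoints"
      using 0 by (intro scaleR_self_adjoints) simp
    have "U_exp_chain h 0 = U_op (jexp (\<i> *\<^sub>C ?k)) 1"
      by (simp add: U_op_one_right scaleC_scaleR jexp_double)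
    then have s: "U_op (jexp (- (\<i> *\<^sub>C ?k))) u \<in> unitaries
        \<and> norm (U_op (jexp (- (\<i> *\<^sub>C ?k))) u - 1) \<le> 1/24
        \<and> u = U_op (jexp (\<i> *\<^sub>C ?k)) (U_op (jexp (- (\<i> *\<^sub>C ?k))) u)"
      using 0 by (intro step[OF k]) simp_all
    then have "U_op (jexp (- (\<i> *\<^sub>C ?k))) u \<in> exp_chains"
      using unitary_near_one_eq_jexp jexp_in_exp_chains by metis
    then show ?case
      by (subst s[THEN conjunct2, THEN conjunct2]) (rule U_op_jexp_in_exp_chains[OF k])
  next
    case (Suc n)
    let ?k = "h (Suc n)"
    have k: "?k \<in> self_adjoints"
      using Suc.prems by simp
    have s: "U_op (jexp (- (\<i> *\<^sub>C ?k))) u \<in> unitaries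
        \<and> norm (U_op (jexp (- (\<i> *\<^sub>C ?k))) u - U_exp_chain h n) \<le> 1/24
        \<and> u = U_op (jexp (\<i> *\<^sub>C ?k)) (U_op (jexp (- (\<i> *\<^sub>C ?k))) u)"
      using Suc.prems by (intro step[OF k]) simp_all
    then have "U_op (jexp (- (\<i> *\<^sub>C ?k))) u \<in> exp_chains"
      using Suc.prems(1) by (intro Suc.IH) auto
    then show ?case
      by (subst s[THEN conjunct2, THEN conjunct2]) (rule U_op_jexp_in_exp_chains[OF k])
  qed
qed

lemma principal_component_eq_exp_chains:
  "principal_component = (exp_chains :: 'a::unital_jb_star_algebra set)"
proof
  let ?P = "principal_component :: 'a set"
  show "exp_chains \<subseteq> ?P"
    by (rule exp_chains_minimal)
      (auto simp: exp_i_self_adjoints_def U_set_def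
        intro: jexp_in_principal_component U_op_principal_component)
  \<comment> \<open>The radius 1/48 is half of 1/24: if two balls meet, their centres are within
    1/24, and \<open>unitary_near_chain\<close> applies.\<close>
  define A B where "A = (\<Union>c\<in>exp_chains. ball (c :: 'a) (1/48))"
    and "B = (\<Union>u\<in>unitaries - exp_chains. ball (u :: 'a) (1/48))"
  have disj: "A \<inter> B = {}"
  proof (rule ccontr)
    assume "A \<inter> B \<noteq> {}"
    then obtain x c u :: 'a where c: "c \<in> exp_chains" "x \<in> ball c (1/48)"
      and u: "u \<in> unitaries" "u \<notin> exp_chains" "x \<in> ball u (1/48)"
      unfolding A_def B_def by blast
    then have "norm (u - c) \<le> 1/24"
      using dist_triangle2[of u c x] by (simp add: dist_norm)
    with c(1) u(1) have "u \<in> exp_chains"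
      using unitary_near_chain by (auto simp: exp_chains_def)
    with u(2) show False ..
  qed
  have "open A" "open B"
    by (auto simp: A_def B_def)
  moreover have "?P \<subseteq> A \<union> B"
    using principal_component_subset by (force simp: A_def B_def)
  ultimately have "A \<inter> ?P = {} \<or> B \<inter> ?P = {}"
    using disj by (intro connectedD[OF connected_principal_component]) auto
  \<comment> \<open>The component meets \<open>A\<close> at 1, so it must be \<open>B\<close> that
    it avoids.\<close>
  moreover have "1 \<in> A"
    unfolding A_def by (rule UN_I[OF one_in_exp_chains]) simp
  ultimately have "B \<inter> ?P = {}"
    using one_in_principal_component by blast
  moreover have "u \<in> B" if "u \<in> unitaries" "u \<notin> exp_chains" for u
    unfolding B_def using that by (intro UN_I[of u]) simp_all
  ultimately show "?P \<subseteq> exp_chains"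
    using principal_component_subset by blast
qed

theorem proposition2p8:
  shows "(principal_component :: 'a::unital_jb_star_algebra set) \<subseteq> unitaries
    \<and> self_adjoint_subset (principal_component :: 'a set)
    \<and> quadratic_subset (principal_component :: 'a set)
    \<and> (\<forall>u\<in>(principal_component :: 'a set). \<forall>w\<in>principal_component.
          star w \<in> principal_component \<and> U_op w u \<in> principal_component)
    \<and> (exp_i_self_adjoints :: 'a set) \<subseteq> principal_component
    \<and> (\<forall>S :: 'a set. S \<subseteq> unitaries \<and> quadratic_subset S \<and> exp_i_self_adjoints \<subseteq> S
          \<longrightarrow> principal_component \<subseteq> S)
    \<and> U_set principal_component principal_component = (principal_component :: 'a set)
    \<and> (principal_component :: 'a set)
        = {U_exp_chain h n | h n. \<forall>j\<le>n. h j \<in> self_adjoints}"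
proof (intro conjI allI impI ballI)
  let ?P = "principal_component :: 'a set"
  show sub: "?P \<subseteq> unitaries"
    by (rule principal_component_subset)
  show "self_adjoint_subset ?P"
    by (auto simp: self_adjoint_subset_def star_principal_component)
  have U: "U_set ?P ?P \<subseteq> ?P"
    by (auto simp: U_set_def U_op_principal_component)
  have "unitaries \<subseteq> (invertibles :: 'a set)"
    by (auto simp: unitaries_def invertibles_def)
  with sub U show "quadratic_subset ?P"
    by (auto simp: quadratic_subset_def)
  show "star w \<in> ?P" "U_op w u \<in> ?P" if "u \<in> ?P" "w \<in> ?P" for u w
    using that by (rule_tac [!] star_principal_component U_op_principal_component)
  show "exp_i_self_adjoints \<subseteq> ?P"
    by (auto simp: exp_i_self_adjoints_def jexp_in_principal_component)
  show "?P \<subseteq> S" if "S \<subseteq> unitaries \<and> quadratic_subset S \<and> exp_i_self_adjoints \<subseteq> S" for S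
    using that exp_chains_minimal[of S]
    by (simp add: principal_component_eq_exp_chains quadratic_subset_def)
  show "U_set ?P ?P = ?P"
  proof
    show "?P \<subseteq> U_set ?P ?P"
    proof
      fix u assume "u \<in> ?P"
      then show "u \<in> U_set ?P ?P"
        \<comment> \<open>Every \<open>u\<close> is the value \<open>U_op 1 u\<close>, and 1 lies in
          the component.\<close>
        unfolding U_set_def using one_in_principal_component U_op_one_left[of u, symmetric] by blast
    qed
  qed (rule U)
  show "?P = {U_exp_chain h n | h n. \<forall>j\<le>n. h j \<in> self_adjoints}"
    by (simp only: principal_component_eq_exp_chains exp_chains_def)
qed

end
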